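(* Let $(\mathfrak g,J)$ and $(\mathfrak g',J')$ be two nilpotent Lie algebras endowed with quasi-nilpotent complex structures. Fix some $k\ge1$ such that $\mathfrak a_k(J)\neq\mathfrak g$, and consider the quotient Lie algebras $\tilde{\mathfrak g}_k=\mathfrak g/\mathfrak a_k(J)$ and $\tilde{\mathfrak g}'_k=\mathfrak g'/\mathfrak a_k(J')$ with their respective induced complex structures $\tilde J_k$ and $\tilde J'_k$. If there is an isomorphism of Lie algebras $f:\mathfrak g\to\mathfrak g'$ such that $f\circ J=J'\circ f$, then the map $\tilde f_k:\tilde{\mathfrak g}_k\to\tilde{\mathfrak g}'_k$ given by $\tilde f_k(\tilde X):=\widetilde{f(X)}$, for every $\tilde X\in\tilde{\mathfrak g}_k$, defines an isomorphism of Lie algebras satisfying $\tilde f_k\circ\tilde J_k=\tilde J'_k\circ\tilde f_k$.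
   Context: Lie algebras are real and finite-dimensional. A complex structure on a Lie algebra $\mathfrak g$ is an endomorphism $J$ with $J^2=-\mathrm{Id}$ and $[X,Y]+J[JX,Y]+J[X,JY]-[JX,JY]=0$ for all $X,Y\in\mathfrak g$. Ascending $J$-compatible series of a nilpotent Lie algebra $\mathfrak g$: $\mathfrak a_0(J)=\{0\}$, $\mathfrak a_k(J)=\{X\in\mathfrak g\mid [X,\mathfrak g]\subseteq\mathfrak a_{k-1}(J),\ [JX,\mathfrak g]\subseteq\mathfrak a_{k-1}(J)\}$ for $k\ge1$. Each $\mathfrak a_k(J)$ is a $J$-invariant ideal. $J$ is quasi-nilpotent if $\mathfrak a_1(J)\neq\{0\}$. The induced complex structure on $\tilde{\mathfrak g}_k=\mathfrak g/\mathfrak a_k(J)$ is $\tilde J_k(\tilde X):=\widetilde{JX}$, where $\tilde X$ denotes the class of $X$ in the quotient (similarly for $\mathfrak g'$). *)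

theory Defs
  imports Complex_Main "HOL-Algebra.Module" "HOL-Algebra.AbelCoset"
begin

definition real_field :: "real ring" where
  "real_field = \<lparr>carrier = UNIV, mult = (*), one = 1, zero = 0, add = (+)\<rparr>"

text \<open>The fields \<^const>\<open>mult\<close> and \<^const>\<open>one\<close> inherited from the record \<open>module\<close> play no role.\<close>

record 'a lie_structure = "(real, 'a) module" +
  bracket :: "'a \<Rightarrow> 'a \<Rightarrow> 'a"

text \<open>Real, finite-dimensional Lie algebras.\<close>

locale lie_algebra = module real_field L for L (structure) +
  assumes bracket_closed:
      "\<lbrakk>X \<in> carrier L; Y \<in> carrier L\<rbrakk> \<Longrightarrow> bracket L X Y \<in> carrier L"
    and bracket_add_left:
      "\<lbrakk>X \<in> carrier L; Y \<in> carrier L; Z \<in> carrier L\<rbrakk> \<Longrightarrow>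
        bracket L (X \<oplus> Y) Z = bracket L X Z \<oplus> bracket L Y Z"
    and bracket_add_right:
      "\<lbrakk>X \<in> carrier L; Y \<in> carrier L; Z \<in> carrier L\<rbrakk> \<Longrightarrow>
        bracket L X (Y \<oplus> Z) = bracket L X Y \<oplus> bracket L X Z"
    and bracket_smult_left:
      "\<lbrakk>X \<in> carrier L; Y \<in> carrier L\<rbrakk> \<Longrightarrow> bracket L (r \<odot> X) Y = r \<odot> bracket L X Y"
    and bracket_smult_right:
      "\<lbrakk>X \<in> carrier L; Y \<in> carrier L\<rbrakk> \<Longrightarrow> bracket L X (r \<odot> Y) = r \<odot> bracket L X Y"
    and bracket_self: "X \<in> carrier L \<Longrightarrow> bracket L X X = \<zero>"
    and jacobi:
      "\<lbrakk>X \<in> carrier L; Y \<in> carrier L; Z \<in> carrier L\<rbrakk> \<Longrightarrow>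
        bracket L X (bracket L Y Z) \<oplus> bracket L Y (bracket L Z X)
          \<oplus> bracket L Z (bracket L X Y) = \<zero>"
    and finite_dimensional:
      "\<exists>B. finite B \<and> B \<subseteq> carrier L \<and>
        (\<forall>X\<in>carrier L. \<exists>c. X = (\<Oplus>b\<in>B. c b \<odot> b))"

fun ascending_central_series :: "('a, 'm) lie_structure_scheme \<Rightarrow> nat \<Rightarrow> 'a set" where
  "ascending_central_series L 0 = {\<zero>\<^bsub>L\<^esub>}"
| "ascending_central_series L (Suc k) =
    {X \<in> carrier L. \<forall>Y\<in>carrier L. bracket L X Y \<in> ascending_central_series L k}"

definition nilpotent_lie_algebra :: "('a, 'm) lie_structure_scheme \<Rightarrow> bool" where
  "nilpotent_lie_algebra L \<longleftrightarrow>
    lie_algebra L \<and> (\<exists>s. ascending_central_series L s = carrier L)"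

definition lie_linear_map ::
  "('a, 'm) lie_structure_scheme \<Rightarrow> ('b, 'n) lie_structure_scheme \<Rightarrow> ('a \<Rightarrow> 'b) \<Rightarrow> bool" where
  "lie_linear_map L M f \<longleftrightarrow>
    (\<forall>X\<in>carrier L. f X \<in> carrier M) \<and>
    (\<forall>X\<in>carrier L. \<forall>Y\<in>carrier L. f (X \<oplus>\<^bsub>L\<^esub> Y) = f X \<oplus>\<^bsub>M\<^esub> f Y) \<and>
    (\<forall>r. \<forall>X\<in>carrier L. f (r \<odot>\<^bsub>L\<^esub> X) = r \<odot>\<^bsub>M\<^esub> f X)"

definition lie_algebra_iso ::
  "('a, 'm) lie_structure_scheme \<Rightarrow> ('b, 'n) lie_structure_scheme \<Rightarrow> ('a \<Rightarrow> 'b) \<Rightarrow> bool" where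
  "lie_algebra_iso L M f \<longleftrightarrow>
    lie_linear_map L M f \<and> bij_betw f (carrier L) (carrier M) \<and>
    (\<forall>X\<in>carrier L. \<forall>Y\<in>carrier L. f (bracket L X Y) = bracket M (f X) (f Y))"

definition complex_structure :: "('a, 'm) lie_structure_scheme \<Rightarrow> ('a \<Rightarrow> 'a) \<Rightarrow> bool" where
  "complex_structure L J \<longleftrightarrow>
    lie_linear_map L L J \<and>
    (\<forall>X\<in>carrier L. J (J X) = \<ominus>\<^bsub>L\<^esub> X) \<and>
    (\<forall>X\<in>carrier L. \<forall>Y\<in>carrier L.
      bracket L X Y \<oplus>\<^bsub>L\<^esub> J (bracket L (J X) Y) \<oplus>\<^bsub>L\<^esub> J (bracket L X (J Y))
        \<ominus>\<^bsub>L\<^esub> bracket L (J X) (J Y) = \<zero>\<^bsub>L\<^esub>)"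

text \<open>The ascending \<open>J\<close>-compatible series \<open>\<aa>\<^sub>k(J)\<close>.\<close>

fun compatible_series ::
  "('a, 'm) lie_structure_scheme \<Rightarrow> ('a \<Rightarrow> 'a) \<Rightarrow> nat \<Rightarrow> 'a set" where
  "compatible_series L J 0 = {\<zero>\<^bsub>L\<^esub>}"
| "compatible_series L J (Suc k) =
    {X \<in> carrier L. (\<forall>Y\<in>carrier L. bracket L X Y \<in> compatible_series L J k) \<and>
                    (\<forall>Y\<in>carrier L. bracket L (J X) Y \<in> compatible_series L J k)}"

definition quasi_nilpotent :: "('a, 'm) lie_structure_scheme \<Rightarrow> ('a \<Rightarrow> 'a) \<Rightarrow> bool" where
  "quasi_nilpotent L J \<longleftrightarrow> complex_structure L J \<and> compatible_series L J 1 \<noteq> {\<zero>\<^bsub>L\<^esub>}"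

text \<open>
  The quotient by an ideal, on cosets, in the style of \<^const>\<open>A_RCOSETS\<close> and \<open>rcoset_mult\<close>:
  each union ranges over representatives and collapses to a single coset when \<open>I\<close> is an ideal.
\<close>

definition lie_quotient ::
  "('a, 'm) lie_structure_scheme \<Rightarrow> 'a set \<Rightarrow> 'a set lie_structure" where
  "lie_quotient L I =
    \<lparr>carrier = a_rcosets\<^bsub>L\<^esub> I, mult = undefined, one = undefined,
     zero = I, add = set_add L,
     smult = (\<lambda>r A. \<Union>X\<in>A. I +>\<^bsub>L\<^esub> (r \<odot>\<^bsub>L\<^esub> X)),
     bracket = (\<lambda>A B. \<Union>X\<in>A. \<Union>Y\<in>B. I +>\<^bsub>L\<^esub> (bracket L X Y))\<rparr>"

text \<open>
  The map into the cosets of \<open>K\<close> in \<open>M\<close> that sends the class of \<open>X\<close> to the class of \<open>f X\<close>;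
  meaningful on a coset \<open>A\<close> only if the class of \<open>f X\<close> is the same for all \<open>X \<in> A\<close>.
\<close>

definition induced_map ::
  "('b, 'n) lie_structure_scheme \<Rightarrow> 'b set \<Rightarrow> ('a \<Rightarrow> 'b) \<Rightarrow> 'a set \<Rightarrow> 'b set" where
  "induced_map M K f A = the_elem ((\<lambda>X. K +>\<^bsub>M\<^esub> f X) ` A)"

abbreviation quotient_k ::
  "('a, 'm) lie_structure_scheme \<Rightarrow> ('a \<Rightarrow> 'a) \<Rightarrow> nat \<Rightarrow> 'a set lie_structure" where
  "quotient_k L J k \<equiv> lie_quotient L (compatible_series L J k)"

abbreviation class_k ::
  "('a, 'm) lie_structure_scheme \<Rightarrow> ('a \<Rightarrow> 'a) \<Rightarrow> nat \<Rightarrow> 'a \<Rightarrow> 'a set" where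
  "class_k L J k X \<equiv> compatible_series L J k +>\<^bsub>L\<^esub> X"

abbreviation induced_J ::
  "('a, 'm) lie_structure_scheme \<Rightarrow> ('a \<Rightarrow> 'a) \<Rightarrow> nat \<Rightarrow> 'a set \<Rightarrow> 'a set" where
  "induced_J L J k \<equiv> induced_map L (compatible_series L J k) J"

end

theory Submission
  imports Defs
begin

text \<open>
  Every assertion reduces to two facts about the series \<open>\<aa>\<^sub>k\<close>, each proved by induction on \<open>k\<close>
  from its recursive description. The first is that \<open>\<aa>\<^sub>k(J)\<close> is a \<open>J\<close>-invariant ideal: with
  \<open>X\<close>, all brackets of \<open>X\<close> and of \<open>J X\<close> with the whole algebra lie in \<open>\<aa>\<^sub>k\<^sub>-\<^sub>1(J)\<close>, this condition
  is linear in \<open>X\<close>, it passes from \<open>X\<close> to \<open>J X\<close> because \<open>J\<^sup>2 = -Id\<close>, and since the series is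
  ascending it makes \<open>\<aa>\<^sub>k(J)\<close> absorb brackets (\<open>compatible_series_lie_ideal\<close>). The second is
  that \<open>\<aa>\<^sub>k\<close> is defined in terms of the bracket and \<open>J\<close> alone, so that an isomorphism intertwining
  \<open>J\<close> and \<open>J'\<close> carries it onto \<open>\<aa>\<^sub>k(J')\<close> (\<open>compatible_series_transport\<close>).

  The rest is the theory of quotients by ideals. The projection to the cosets is surjective and
  commutes with all operations, so identities such as the Jacobi identity and the integrability
  of \<open>J\<close> descend to the quotient. A linear map sending the ideal \<open>I\<close> into \<open>K\<close> induces a map on cosets,
  computed on representatives (\<open>induced_map_class\<close>), and the induced map is injective
  as soon as only the elements of \<open>I\<close> are sent into \<open>K\<close>.
\<close>

section \<open>Real scalars and linear maps\<close>

lemma real_field_simps [simp]: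
  "carrier real_field = UNIV" "a \<otimes>\<^bsub>real_field\<^esub> b = a * b" "a \<oplus>\<^bsub>real_field\<^esub> b = a + b"
  "\<one>\<^bsub>real_field\<^esub> = 1" "\<zero>\<^bsub>real_field\<^esub> = 0"
  by (simp_all add: real_field_def)

context lie_algebra
begin

lemma smult_real_closed [simp, intro]: "X \<in> carrier L \<Longrightarrow> (r::real) \<odot> X \<in> carrier L"
  by (rule smult_closed) simp_all

lemma smult_real_add: "X \<in> carrier L \<Longrightarrow> (r + s) \<odot> X = r \<odot> X \<oplus> s \<odot> X"
  using smult_l_distr[of r s X] by simp

lemma smult_real_zero: "X \<in> carrier L \<Longrightarrow> 0 \<odot> X = \<zero>"
  using smult_l_null[of X] by simp

lemma smult_real_one: "X \<in> carrier L \<Longrightarrow> 1 \<odot> X = X"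
  using smult_one[of X] by simp

lemma minus_conv_smult:
  assumes "X \<in> carrier L"
  shows "\<ominus> X = (-1) \<odot> X"
proof (rule minus_equality)
  have "(-1) \<odot> X \<oplus> X = (-1 + 1) \<odot> X"
    using assms by (simp only: smult_real_add smult_real_one)
  then show "(-1) \<odot> X \<oplus> X = \<zero>"
    using assms by (simp add: smult_real_zero)
qed (use assms in auto)

lemma bracket_zero_left:
  assumes "X \<in> carrier L"
  shows "bracket L \<zero> X = \<zero>"
proof -
  have "bracket L (0 \<odot> \<zero>) X = 0 \<odot> bracket L \<zero> X"
    using assms by (intro bracket_smult_left) auto
  then show ?thesis
    using assms by (simp add: smult_real_zero bracket_closed)
qed

lemma bracket_minus_left:
  "\<lbrakk>X \<in> carrier L; Y \<in> carrier L\<rbrakk> \<Longrightarrow> bracket L (\<ominus> X) Y = \<ominus> bracket L X Y"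
  by (simp add: minus_conv_smult bracket_smult_left bracket_closed)

lemma bracket_antisym:
  assumes X: "X \<in> carrier L" and Y: "Y \<in> carrier L"
  shows "bracket L Y X = \<ominus> bracket L X Y"
proof -
  have "\<zero> = bracket L (X \<oplus> Y) (X \<oplus> Y)"
    using X Y by (simp add: bracket_self)
  also have "\<dots> = bracket L X (X \<oplus> Y) \<oplus> bracket L Y (X \<oplus> Y)"
    using X Y by (intro bracket_add_left) auto
  also have "\<dots> = bracket L Y X \<oplus> bracket L X Y"
    using X Y by (simp add: bracket_add_right bracket_self bracket_closed a_comm)
  finally have "bracket L Y X \<oplus> bracket L X Y = \<zero>" by (rule sym)
  from minus_equality[OF this] show ?thesis
    using X Y by (simp add: bracket_closed)
qed

end

lemma lie_linear_mapD:
  assumes "lie_linear_map L M f"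
  shows "X \<in> carrier L \<Longrightarrow> f X \<in> carrier M"
    and "\<lbrakk>X \<in> carrier L; Y \<in> carrier L\<rbrakk> \<Longrightarrow> f (X \<oplus>\<^bsub>L\<^esub> Y) = f X \<oplus>\<^bsub>M\<^esub> f Y"
    and "X \<in> carrier L \<Longrightarrow> f (r \<odot>\<^bsub>L\<^esub> X) = r \<odot>\<^bsub>M\<^esub> f X"
  using assms unfolding lie_linear_map_def by blast+

lemma lie_linear_map_zero:
  assumes "lie_algebra L" "lie_algebra M" "lie_linear_map L M f"
  shows "f \<zero>\<^bsub>L\<^esub> = \<zero>\<^bsub>M\<^esub>"
proof -
  interpret L: lie_algebra L by fact
  interpret M: lie_algebra M by fact
  note f = lie_linear_mapD[OF assms(3)]
  have "f (0 \<odot>\<^bsub>L\<^esub> \<zero>\<^bsub>L\<^esub>) = 0 \<odot>\<^bsub>M\<^esub> f \<zero>\<^bsub>L\<^esub>" by (rule f(3)) simp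
  then show ?thesis using f(1)[of "\<zero>\<^bsub>L\<^esub>"] by (simp add: L.smult_real_zero M.smult_real_zero)
qed

lemma lie_linear_map_minus:
  assumes "lie_algebra L" "lie_algebra M" "lie_linear_map L M f" "X \<in> carrier L"
  shows "f (\<ominus>\<^bsub>L\<^esub> X) = \<ominus>\<^bsub>M\<^esub> f X"
  using lie_linear_mapD[OF assms(3)] assms(4)
  by (simp add: lie_algebra.minus_conv_smult[OF assms(1)] lie_algebra.minus_conv_smult[OF assms(2)])

section \<open>Surjective images of Lie algebras\<close>

text \<open>
  Spanning sets are mapped to spanning sets. As \<open>p\<close> may identify members of \<open>B\<close>, the coefficients
  of an element of \<open>p ` B\<close> have to be collected over its fibre, which the induction does one
  member at a time.
\<close>

lemma image_of_linear_combination: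
  fixes c :: "'a \<Rightarrow> real"
  assumes L: "lie_algebra L" and M: "module real_field M" and p: "lie_linear_map L M p"
    and zero: "p \<zero>\<^bsub>L\<^esub> = \<zero>\<^bsub>M\<^esub>"
    and B: "finite B" "B \<subseteq> carrier L"
  shows "\<exists>d. p (\<Oplus>\<^bsub>L\<^esub>b\<in>B. c b \<odot>\<^bsub>L\<^esub> b) = (\<Oplus>\<^bsub>M\<^esub>y\<in>p ` B. d y \<odot>\<^bsub>M\<^esub> y)"
  using B
proof (induction B rule: finite_induct)
  case empty
  interpret L: lie_algebra L by fact
  interpret M: module real_field M by fact
  show ?case using zero by simp
next
  case (insert b B)
  interpret L: lie_algebra L by fact
  interpret M: module real_field M by fact
  note p = lie_linear_mapD[OF p]
  have b: "b \<in> carrier L" and B: "B \<subseteq> carrier L" using insert.prems by auto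
  have pB: "p ` B \<subseteq> carrier M" and pb: "p b \<in> carrier M" using b B p(1) by auto
  have closed: "(r::real) \<odot>\<^bsub>M\<^esub> y \<in> carrier M" if "y \<in> carrier M" for r y
    using that by (intro M.smult_closed) auto
  obtain d where d: "p (\<Oplus>\<^bsub>L\<^esub>b\<in>B. c b \<odot>\<^bsub>L\<^esub> b) = (\<Oplus>\<^bsub>M\<^esub>y\<in>p ` B. d y \<odot>\<^bsub>M\<^esub> y)"
    using insert.IH B by blast
  have "(\<Oplus>\<^bsub>L\<^esub>b\<in>insert b B. c b \<odot>\<^bsub>L\<^esub> b) = c b \<odot>\<^bsub>L\<^esub> b \<oplus>\<^bsub>L\<^esub> (\<Oplus>\<^bsub>L\<^esub>b\<in>B. c b \<odot>\<^bsub>L\<^esub> b)"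
    using b B insert.hyps by (intro L.finsum_insert) auto
  moreover have "(\<Oplus>\<^bsub>L\<^esub>b\<in>B. c b \<odot>\<^bsub>L\<^esub> b) \<in> carrier L"
    using B by (intro L.finsum_closed) auto
  ultimately have split: "p (\<Oplus>\<^bsub>L\<^esub>b\<in>insert b B. c b \<odot>\<^bsub>L\<^esub> b)
      = c b \<odot>\<^bsub>M\<^esub> p b \<oplus>\<^bsub>M\<^esub> (\<Oplus>\<^bsub>M\<^esub>y\<in>p ` B. d y \<odot>\<^bsub>M\<^esub> y)"
    using b by (simp add: p d)
  define C where "C = p ` B - {p b}"
  have C: "finite C" "p b \<notin> C" "C \<subseteq> carrier M"
    using insert.hyps pB by (auto simp: C_def)
  have sum_insert: "(\<Oplus>\<^bsub>M\<^esub>y\<in>insert (p b) C. e y \<odot>\<^bsub>M\<^esub> y)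
      = e (p b) \<odot>\<^bsub>M\<^esub> p b \<oplus>\<^bsub>M\<^esub> (\<Oplus>\<^bsub>M\<^esub>y\<in>C. e y \<odot>\<^bsub>M\<^esub> y)" for e :: "'c \<Rightarrow> real"
    using C pb by (intro M.finsum_insert) (auto intro: closed)
  define S where "S = (\<Oplus>\<^bsub>M\<^esub>y\<in>C. d y \<odot>\<^bsub>M\<^esub> y)"
  have S: "S \<in> carrier M" unfolding S_def using C by (intro M.finsum_closed) (auto intro: closed)
  have upd: "(\<Oplus>\<^bsub>M\<^esub>y\<in>C. (d(p b := r)) y \<odot>\<^bsub>M\<^esub> y) = S" for r
    unfolding S_def using C by (intro M.finsum_cong') (auto intro: closed)
  have image: "p ` insert b B = insert (p b) C" by (auto simp: C_def)
  show ?case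
  proof (cases "p b \<in> p ` B")
    case True
    then have "p ` B = insert (p b) C" by (auto simp: C_def)
    then have "p (\<Oplus>\<^bsub>L\<^esub>b\<in>insert b B. c b \<odot>\<^bsub>L\<^esub> b)
        = c b \<odot>\<^bsub>M\<^esub> p b \<oplus>\<^bsub>M\<^esub> (d (p b) \<odot>\<^bsub>M\<^esub> p b \<oplus>\<^bsub>M\<^esub> S)"
      using split sum_insert[of d] by (simp add: S_def)
    also have "\<dots> = (c b + d (p b)) \<odot>\<^bsub>M\<^esub> p b \<oplus>\<^bsub>M\<^esub> S"
      using M.smult_l_distr[of "c b" "d (p b)" "p b"] pb S by (simp add: closed M.add.m_assoc)
    also have "\<dots> = (\<Oplus>\<^bsub>M\<^esub>y\<in>p ` insert b B. (d(p b := c b + d (p b))) y \<odot>\<^bsub>M\<^esub> y)"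
      unfolding image sum_insert upd by simp
    finally show ?thesis by blast
  next
    case False
    then have "p ` B = C" by (auto simp: C_def)
    then have "p (\<Oplus>\<^bsub>L\<^esub>b\<in>insert b B. c b \<odot>\<^bsub>L\<^esub> b) = c b \<odot>\<^bsub>M\<^esub> p b \<oplus>\<^bsub>M\<^esub> S"
      using split by (simp add: S_def)
    also have "\<dots> = (\<Oplus>\<^bsub>M\<^esub>y\<in>p ` insert b B. (d(p b := c b)) y \<odot>\<^bsub>M\<^esub> y)"
      unfolding image sum_insert upd by simp
    finally show ?thesis by blast
  qed
qed

text \<open>
  The axioms of a Lie algebra are identities, apart from the existence of negatives and of a finite
  spanning set, and all of these survive under a surjection compatible with the operations.
\<close>

lemma lie_algebra_surjective_image:
  assumes L: "lie_algebra L" and p: "lie_linear_map L M p"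
    and surj: "carrier M = p ` carrier L" and zero: "p \<zero>\<^bsub>L\<^esub> = \<zero>\<^bsub>M\<^esub>"
    and bracket: "\<And>X Y. \<lbrakk>X \<in> carrier L; Y \<in> carrier L\<rbrakk> \<Longrightarrow>
      p (bracket L X Y) = bracket M (p X) (p Y)"
  shows "lie_algebra M"
proof -
  interpret L: lie_algebra L by fact
  note lin = lie_linear_mapD[OF p]
  note hom = lin(2,3)[symmetric] bracket[symmetric]
  have group: "abelian_group M"
  proof (rule abelian_groupI)
    show "\<exists>y\<in>carrier M. y \<oplus>\<^bsub>M\<^esub> x = \<zero>\<^bsub>M\<^esub>" if x: "x \<in> carrier M" for x
    proof -
      obtain X where X: "X \<in> carrier L" "x = p X" using x surj by auto
      have "p (\<ominus>\<^bsub>L\<^esub> X) \<oplus>\<^bsub>M\<^esub> x = p (\<ominus>\<^bsub>L\<^esub> X \<oplus>\<^bsub>L\<^esub> X)"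
        using X by (simp add: hom)
      then show ?thesis using X zero lin(1)[of "\<ominus>\<^bsub>L\<^esub> X"] by (auto simp: L.l_neg)
    qed
  qed (auto simp: surj hom zero[symmetric] L.a_ac)
  have module: "module real_field M"
    by (rule moduleI[OF L.R.cring_axioms group])
      (auto simp: surj hom L.smult_real_add L.smult_real_one
        L.smult_r_distr[simplified] L.smult_assoc1[simplified])
  show ?thesis
  proof (rule lie_algebra.intro[OF module lie_algebra_axioms.intro])
    obtain B where B: "finite B" "B \<subseteq> carrier L"
      and span: "\<And>X. X \<in> carrier L \<Longrightarrow> \<exists>c. X = (\<Oplus>\<^bsub>L\<^esub>b\<in>B. c b \<odot>\<^bsub>L\<^esub> b)"
      using L.finite_dimensional by blast
    have "\<exists>d. x = (\<Oplus>\<^bsub>M\<^esub>y\<in>p ` B. d y \<odot>\<^bsub>M\<^esub> y)" if x: "x \<in> carrier M" for x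
    proof -
      obtain X where X: "X \<in> carrier L" "x = p X" using x surj by auto
      then obtain c where "X = (\<Oplus>\<^bsub>L\<^esub>b\<in>B. c b \<odot>\<^bsub>L\<^esub> b)" using span by blast
      then show ?thesis
        using image_of_linear_combination[OF L module p zero B, of c] X by simp
    qed
    then show "\<exists>B. finite B \<and> B \<subseteq> carrier M \<and>
        (\<forall>X\<in>carrier M. \<exists>c. X = (\<Oplus>\<^bsub>M\<^esub>b\<in>B. c b \<odot>\<^bsub>M\<^esub> b))"
      using B lin(1) by (intro exI[of _ "p ` B"]) auto
  qed (auto simp: surj hom zero[symmetric] L.bracket_closed L.bracket_add_left L.bracket_add_right
      L.bracket_smult_left L.bracket_smult_right L.bracket_self L.jacobi)
qed

section \<open>Quotients by ideals\<close>

text \<open>Absorption on one side suffices because the bracket is antisymmetric.\<close>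

locale lie_ideal = lie_algebra L for I and L (structure) +
  assumes ideal_subset: "I \<subseteq> carrier L"
    and ideal_zero: "\<zero> \<in> I"
    and ideal_add: "\<lbrakk>X \<in> I; Y \<in> I\<rbrakk> \<Longrightarrow> X \<oplus> Y \<in> I"
    and ideal_smult: "X \<in> I \<Longrightarrow> r \<odot> X \<in> I"
    and ideal_bracket: "\<lbrakk>X \<in> I; Y \<in> carrier L\<rbrakk> \<Longrightarrow> bracket L X Y \<in> I"

sublocale lie_ideal \<subseteq> abelian_subgroup I L
proof (rule abelian_subgroupI3)
  show "additive_subgroup I L"
  proof (rule additive_subgroup.intro, rule add.subgroupI)
    show "\<ominus> X \<in> I" if "X \<in> I" for X
      using that ideal_subset ideal_smult[of X "-1"] minus_conv_smult[of X] by auto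
  qed (use ideal_subset ideal_zero ideal_add in auto)
qed (rule abelian_group_axioms)

context lie_ideal
begin

lemma ideal_bracket_right:
  assumes "X \<in> carrier L" "Y \<in> I"
  shows "bracket L X Y \<in> I"
  using assms ideal_subset bracket_antisym[of Y X] by (auto intro: ideal_bracket)

lemma class_memberE:
  assumes "Z \<in> I +> X"
  obtains H where "H \<in> I" "Z = H \<oplus> X"
  using assms by (auto simp: a_r_coset_def')

lemma class_absorb: "\<lbrakk>H \<in> I; X \<in> carrier L\<rbrakk> \<Longrightarrow> I +> (H \<oplus> X) = I +> X"
  using ideal_subset by (metis a_coset_add_assoc a_coset_join2 is_additive_subgroup
      additive_subgroup.a_subgroup subsetD)

lemma class_eq_iff:
  assumes X: "X \<in> carrier L" and Y: "Y \<in> carrier L"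
  shows "I +> X = I +> Y \<longleftrightarrow> X \<ominus> Y \<in> I"
proof
  assume "I +> X = I +> Y"
  then have "X \<in> I +> Y" using a_rcos_self[OF X] by simp
  then obtain H where "H \<in> I" "X = H \<oplus> Y" by (rule class_memberE)
  then show "X \<ominus> Y \<in> I" using Y ideal_subset by (auto simp: minus_eq a_assoc r_neg)
next
  assume "X \<ominus> Y \<in> I"
  moreover have "X = (X \<ominus> Y) \<oplus> Y" using X Y by (simp add: minus_eq a_assoc l_neg)
  ultimately show "I +> X = I +> Y" using class_absorb[of "X \<ominus> Y" Y] Y by simp
qed

lemma carrier_quotient: "carrier (lie_quotient L I) = (\<lambda>X. I +> X) ` carrier L"
  by (auto simp: lie_quotient_def A_RCOSETS_def')

lemma zero_quotient: "\<zero>\<^bsub>lie_quotient L I\<^esub> = I +> \<zero>"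
  using ideal_subset by (simp add: lie_quotient_def)

lemma add_quotient_class:
  "\<lbrakk>X \<in> carrier L; Y \<in> carrier L\<rbrakk> \<Longrightarrow>
    (I +> X) \<oplus>\<^bsub>lie_quotient L I\<^esub> (I +> Y) = I +> (X \<oplus> Y)"
  by (simp add: lie_quotient_def a_rcos_sum)

lemma smult_quotient_class:
  assumes X: "X \<in> carrier L"
  shows "r \<odot>\<^bsub>lie_quotient L I\<^esub> (I +> X) = I +> (r \<odot> X)"
proof -
  have "I +> (r \<odot> Z) = I +> (r \<odot> X)" if "Z \<in> I +> X" for Z
  proof -
    from that obtain H where H: "H \<in> I" "Z = H \<oplus> X" by (rule class_memberE)
    then have "r \<odot> Z = r \<odot> H \<oplus> r \<odot> X" using X ideal_subset smult_r_distr[of r H X] by auto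
    then show ?thesis using H X by (simp add: class_absorb ideal_smult)
  qed
  then have "(\<Union>Z\<in>I +> X. I +> (r \<odot> Z)) = I +> (r \<odot> X)"
    by (intro UN_constant_eq[OF a_rcos_self[OF X]] ballI)
  then show ?thesis by (simp add: lie_quotient_def)
qed

text \<open>
  With \<open>H\<close> and \<open>K\<close> in the ideal, \<open>[H + X, K + Y]\<close> is \<open>[H, K + Y] + [X, K] + [X, Y]\<close>, and the first
  two terms lie in \<open>I\<close>, one by absorption on the left and the other on the right.
\<close>

lemma bracket_quotient_class:
  assumes X: "X \<in> carrier L" and Y: "Y \<in> carrier L"
  shows "bracket (lie_quotient L I) (I +> X) (I +> Y) = I +> bracket L X Y"
proof -
  have "I +> bracket L Z W = I +> bracket L X Y" if "Z \<in> I +> X" "W \<in> I +> Y" for Z W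
  proof -
    from that(1) obtain H where H: "H \<in> I" "Z = H \<oplus> X" by (rule class_memberE)
    from that(2) obtain K where K: "K \<in> I" "W = K \<oplus> Y" by (rule class_memberE)
    have HK: "H \<in> carrier L" "K \<in> carrier L" using H K ideal_subset by auto
    then have "bracket L Z W = bracket L H W \<oplus> (bracket L X K \<oplus> bracket L X Y)"
      using H K X Y bracket_add_left[of H X W] bracket_add_right[of X K Y] by simp
    moreover have "bracket L H W \<in> I" "bracket L X K \<in> I"
      using H K HK X Y by (auto intro: ideal_bracket ideal_bracket_right)
    ultimately show ?thesis using X Y HK by (simp add: class_absorb bracket_closed)
  qed
  then have "(\<Union>Z\<in>I +> X. \<Union>W\<in>I +> Y. I +> bracket L Z W) = I +> bracket L X Y"
    by (intro UN_constant_eq[OF a_rcos_self[OF X]] UN_constant_eq[OF a_rcos_self[OF Y]] ballI)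
  then show ?thesis by (simp add: lie_quotient_def)
qed

lemma lie_linear_map_class: "lie_linear_map L (lie_quotient L I) (\<lambda>X. I +> X)"
  by (simp add: lie_linear_map_def carrier_quotient add_quotient_class smult_quotient_class)

theorem lie_algebra_quotient: "lie_algebra (lie_quotient L I)"
  by (rule lie_algebra_surjective_image[OF lie_algebra_axioms lie_linear_map_class])
    (simp_all add: carrier_quotient zero_quotient bracket_quotient_class)

lemma minus_quotient_class:
  "X \<in> carrier L \<Longrightarrow> \<ominus>\<^bsub>lie_quotient L I\<^esub> (I +> X) = I +> (\<ominus> X)"
  using lie_linear_map_minus[OF lie_algebra_axioms lie_algebra_quotient lie_linear_map_class]
  by simp

end

text \<open>
  Two representatives of a class differ by an element of \<open>I\<close>, so their images differ by an element
  of \<open>K\<close>: the image family defining the induced map is a singleton.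
\<close>

lemma induced_map_class:
  assumes I: "lie_ideal I L" and K: "lie_ideal K M" and f: "lie_linear_map L M f"
    and fI: "\<And>X. X \<in> I \<Longrightarrow> f X \<in> K" and X: "X \<in> carrier L"
  shows "induced_map M K f (I +>\<^bsub>L\<^esub> X) = K +>\<^bsub>M\<^esub> f X"
proof -
  interpret I: lie_ideal I L by fact
  interpret K: lie_ideal K M by fact
  note f = lie_linear_mapD[OF f]
  have "K +>\<^bsub>M\<^esub> f Z = K +>\<^bsub>M\<^esub> f X" if "Z \<in> I +>\<^bsub>L\<^esub> X" for Z
  proof -
    from that obtain H where "H \<in> I" "Z = H \<oplus>\<^bsub>L\<^esub> X" by (rule I.class_memberE)
    then show ?thesis using X I.ideal_subset by (auto simp: f K.class_absorb fI)
  qed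
  then have "(\<lambda>Z. K +>\<^bsub>M\<^esub> f Z) ` (I +>\<^bsub>L\<^esub> X) = (\<lambda>_. K +>\<^bsub>M\<^esub> f X) ` (I +>\<^bsub>L\<^esub> X)"
    by (intro image_cong refl)
  also have "\<dots> = {K +>\<^bsub>M\<^esub> f X}" using I.a_rcos_self[OF X] by auto
  finally show ?thesis by (simp add: induced_map_def)
qed

lemma lie_linear_map_induced:
  assumes I: "lie_ideal I L" and K: "lie_ideal K M" and f: "lie_linear_map L M f"
    and fI: "\<And>X. X \<in> I \<Longrightarrow> f X \<in> K"
  shows "lie_linear_map (lie_quotient L I) (lie_quotient M K) (induced_map M K f)"
proof -
  interpret I: lie_ideal I L by fact
  interpret K: lie_ideal K M by fact
  note f_lin = lie_linear_mapD[OF f]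
  note induced = induced_map_class[OF I K f fI]
  show ?thesis
    by (auto simp: lie_linear_map_def I.carrier_quotient K.carrier_quotient f_lin induced
        I.add_quotient_class K.add_quotient_class I.smult_quotient_class K.smult_quotient_class)
qed

lemma complex_structure_quotient:
  assumes I: "lie_ideal I L" and J: "complex_structure L J"
    and JI: "\<And>X. X \<in> I \<Longrightarrow> J X \<in> I"
  shows "complex_structure (lie_quotient L I) (induced_map L I J)"
proof -
  interpret I: lie_ideal I L by fact
  have lin: "lie_linear_map L L J" using J by (simp add: complex_structure_def)
  note J_lin = lie_linear_mapD[OF lin]
  note induced = induced_map_class[OF I I lin JI]
  note ops = I.carrier_quotient I.zero_quotient I.add_quotient_class I.bracket_quotient_class
    I.minus_quotient_class
  have sub: "(I +>\<^bsub>L\<^esub> X) \<ominus>\<^bsub>lie_quotient L I\<^esub> (I +>\<^bsub>L\<^esub> Y) = I +>\<^bsub>L\<^esub> (X \<ominus>\<^bsub>L\<^esub> Y)"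
    if "X \<in> carrier L" "Y \<in> carrier L" for X Y
    using that by (simp add: a_minus_def ops)
  show ?thesis
    using J lie_linear_map_induced[OF I I lin JI]
    by (auto simp: complex_structure_def ops sub induced J_lin I.bracket_closed)
qed

text \<open>
  That \<open>I\<close> is sent into \<open>K\<close> makes the induced map well defined; that nothing else is sent
  into \<open>K\<close> makes it injective, since equal image classes mean \<open>f (X - Y) \<in> K\<close>.
\<close>

lemma lie_algebra_iso_quotient:
  assumes I: "lie_ideal I L" and K: "lie_ideal K M" and iso: "lie_algebra_iso L M f"
    and ideals: "\<And>X. X \<in> carrier L \<Longrightarrow> f X \<in> K \<longleftrightarrow> X \<in> I"
  shows "lie_algebra_iso (lie_quotient L I) (lie_quotient M K) (induced_map M K f)"
proof -
  interpret I: lie_ideal I L by fact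
  interpret K: lie_ideal K M by fact
  have lin: "lie_linear_map L M f" and surj: "f ` carrier L = carrier M"
    and bracket: "\<And>X Y. \<lbrakk>X \<in> carrier L; Y \<in> carrier L\<rbrakk> \<Longrightarrow>
      f (bracket L X Y) = bracket M (f X) (f Y)"
    using iso by (auto simp: lie_algebra_iso_def bij_betw_def)
  note f = lie_linear_mapD[OF lin]
  have fI: "f X \<in> K" if "X \<in> I" for X using that ideals I.ideal_subset by auto
  note induced = induced_map_class[OF I K lin fI]
  have "inj_on (induced_map M K f) (carrier (lie_quotient L I))"
  proof (rule inj_onI)
    fix A B
    assume A: "A \<in> carrier (lie_quotient L I)" and B: "B \<in> carrier (lie_quotient L I)"
      and eq: "induced_map M K f A = induced_map M K f B"
    obtain X where X: "X \<in> carrier L" "A = I +>\<^bsub>L\<^esub> X" using A by (auto simp: I.carrier_quotient)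
    obtain Y where Y: "Y \<in> carrier L" "B = I +>\<^bsub>L\<^esub> Y" using B by (auto simp: I.carrier_quotient)
    have "f X \<ominus>\<^bsub>M\<^esub> f Y \<in> K" using eq X Y by (simp add: induced K.class_eq_iff f)
    moreover have "f X \<ominus>\<^bsub>M\<^esub> f Y = f (X \<ominus>\<^bsub>L\<^esub> Y)"
      using X Y lie_linear_map_minus[OF I.lie_algebra_axioms K.lie_algebra_axioms lin Y(1)]
      by (simp add: a_minus_def f)
    ultimately show "A = B" using X Y ideals[of "X \<ominus>\<^bsub>L\<^esub> Y"] by (simp add: I.class_eq_iff)
  qed
  moreover have "induced_map M K f ` carrier (lie_quotient L I) = carrier (lie_quotient M K)"
    unfolding I.carrier_quotient K.carrier_quotient surj[symmetric] image_image
    by (rule image_cong) (simp_all add: induced)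
  ultimately show ?thesis
    using lie_linear_map_induced[OF I K lin fI]
    by (auto simp: lie_algebra_iso_def bij_betw_def I.carrier_quotient f bracket induced
        I.bracket_quotient_class K.bracket_quotient_class I.bracket_closed)
qed

section \<open>The ascending series compatible with a complex structure\<close>

lemma compatible_series_mono:
  assumes L: "lie_algebra L" and J: "lie_linear_map L L J"
  shows "compatible_series L J k \<subseteq> compatible_series L J (Suc k)"
proof (induction k)
  case 0
  interpret lie_algebra L by fact
  show ?case by (simp add: bracket_zero_left lie_linear_map_zero[OF L L J])
next
  case (Suc k)
  then show ?case by auto
qed

text \<open>
  The assertions are proved together: closure of the next member under \<open>J\<close> needs closure of the
  present one under negation, as \<open>[J (J X), Y] = - [X, Y]\<close>. Absorption of
  brackets holds because brackets even drop to the previous member, and the series is ascending.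
\<close>

lemma compatible_series_lie_ideal:
  assumes L: "lie_algebra L" and J: "complex_structure L J"
  shows "lie_ideal (compatible_series L J k) L \<and>
    (\<forall>X\<in>compatible_series L J k. J X \<in> compatible_series L J k)"
proof (induction k)
  interpret lie_algebra L by fact
  have lin: "lie_linear_map L L J" and JJ: "\<And>X. X \<in> carrier L \<Longrightarrow> J (J X) = \<ominus>\<^bsub>L\<^esub> X"
    using J by (simp_all add: complex_structure_def)
  note J_lin = lie_linear_mapD[OF lin] lie_linear_map_zero[OF L L lin]
  {
    case 0
    show ?case
      using smult_r_null by (auto intro!: lie_ideal.intro L lie_ideal_axioms.intro
          simp: bracket_zero_left J_lin)
  next
    case (Suc k)
    let ?a = "compatible_series L J"
    interpret I: lie_ideal "?a k" L using Suc by blast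
    have "bracket L X Y \<in> ?a (Suc k)" if "X \<in> ?a (Suc k)" "Y \<in> carrier L" for X Y
      using that compatible_series_mono[OF L lin, of k] by auto
    then have "lie_ideal (?a (Suc k)) L"
      by (auto intro!: lie_ideal.intro L lie_ideal_axioms.intro simp: J_lin bracket_zero_left
          bracket_add_left bracket_smult_left I.ideal_zero I.ideal_add I.ideal_smult)
    moreover have "\<forall>X\<in>?a (Suc k). J X \<in> ?a (Suc k)"
      by (auto simp: J_lin JJ bracket_minus_left)
    ultimately show ?case by blast
  }
qed

text \<open>
  Injectivity of \<open>f\<close> settles \<open>\<aa>\<^sub>0\<close>. In the induction step surjectivity matters: the condition on
  \<open>f X\<close> quantifies over all of \<open>M\<close>, and only because every element of \<open>M\<close> is some \<open>f Y\<close> does it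
  reduce to the brackets \<open>f [X, Y]\<close> and \<open>f [J X, Y]\<close> that the induction hypothesis covers.
\<close>

lemma compatible_series_transport:
  assumes L: "lie_algebra L" and M: "lie_algebra M"
    and iso: "lie_algebra_iso L M f" and J: "lie_linear_map L L J"
    and fJ: "\<And>X. X \<in> carrier L \<Longrightarrow> f (J X) = J' (f X)"
    and X: "X \<in> carrier L"
  shows "f X \<in> compatible_series M J' k \<longleftrightarrow> X \<in> compatible_series L J k"
  using X
proof (induction k arbitrary: X)
  case 0
  interpret L: lie_algebra L by fact
  have "inj_on f (carrier L)" and "f \<zero>\<^bsub>L\<^esub> = \<zero>\<^bsub>M\<^esub>"
    using iso lie_linear_map_zero[OF L M] by (auto simp: lie_algebra_iso_def bij_betw_def)
  then show ?case using 0 inj_onD[of f "carrier L" X "\<zero>\<^bsub>L\<^esub>"] by auto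
next
  case (Suc k)
  interpret L: lie_algebra L by fact
  have lin: "lie_linear_map L M f" and surj: "carrier M = f ` carrier L"
    and bracket: "\<And>X Y. \<lbrakk>X \<in> carrier L; Y \<in> carrier L\<rbrakk> \<Longrightarrow>
      bracket M (f X) (f Y) = f (bracket L X Y)"
    using iso by (auto simp: lie_algebra_iso_def bij_betw_def)
  show ?case
    using Suc.prems lie_linear_mapD(1)[OF J]
    by (simp add: surj bracket fJ[symmetric] Suc.IH L.bracket_closed)
qed

theorem proposition2p7:
  fixes g :: "'a lie_structure" and g' :: "'b lie_structure"
    and J :: "'a \<Rightarrow> 'a" and J' :: "'b \<Rightarrow> 'b"
    and f :: "'a \<Rightarrow> 'b" and k :: nat
  assumes "nilpotent_lie_algebra g" and "quasi_nilpotent g J"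
    and "nilpotent_lie_algebra g'" and "quasi_nilpotent g' J'"
    and "k \<ge> 1" and "compatible_series g J k \<noteq> carrier g"
    and "lie_algebra_iso g g' f"
    and "\<forall>X\<in>carrier g. f (J X) = J' (f X)"
  shows
    "let f_k = induced_map g' (compatible_series g' J' k) f in
      lie_algebra (quotient_k g J k) \<and> lie_algebra (quotient_k g' J' k) \<and>
      (\<forall>X\<in>carrier g. induced_J g J k (class_k g J k X) = class_k g J k (J X)) \<and>
      (\<forall>X\<in>carrier g'. induced_J g' J' k (class_k g' J' k X) = class_k g' J' k (J' X)) \<and>
      complex_structure (quotient_k g J k) (induced_J g J k) \<and>
      complex_structure (quotient_k g' J' k) (induced_J g' J' k) \<and>
      (\<forall>X\<in>carrier g. f_k (class_k g J k X) = class_k g' J' k (f X)) \<and>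
      lie_algebra_iso (quotient_k g J k) (quotient_k g' J' k) f_k \<and>
      (\<forall>A\<in>carrier (quotient_k g J k).
        f_k (induced_J g J k A) = induced_J g' J' k (f_k A))"
proof -
  let ?I = "compatible_series g J k" and ?K = "compatible_series g' J' k"
  have g: "lie_algebra g" and g': "lie_algebra g'"
    using assms(1,3) by (auto simp: nilpotent_lie_algebra_def)
  have J: "complex_structure g J" and J': "complex_structure g' J'"
    using assms(2,4) by (auto simp: quasi_nilpotent_def)
  have I: "lie_ideal ?I g" and JI: "\<And>X. X \<in> ?I \<Longrightarrow> J X \<in> ?I"
    using compatible_series_lie_ideal[OF g J] by blast+
  have K: "lie_ideal ?K g'" and JK: "\<And>X. X \<in> ?K \<Longrightarrow> J' X \<in> ?K"
    using compatible_series_lie_ideal[OF g' J'] by blast+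
  interpret I: lie_ideal ?I g by (rule I)
  have J_lin: "lie_linear_map g g J" and J'_lin: "lie_linear_map g' g' J'"
    using J J' by (simp_all add: complex_structure_def)
  have f_lin: "lie_linear_map g g' f" using assms(7) by (simp add: lie_algebra_iso_def)
  have fJ: "\<And>X. X \<in> carrier g \<Longrightarrow> f (J X) = J' (f X)" using assms(8) by blast
  note transport = compatible_series_transport[OF g g' assms(7) J_lin fJ]
  have fI: "f X \<in> ?K" if "X \<in> ?I" for X using that transport I.ideal_subset by auto
  note induced_J = induced_map_class[OF I I J_lin JI]
  note induced_J' = induced_map_class[OF K K J'_lin JK]
  note induced_f = induced_map_class[OF I K f_lin fI]
  have commute: "induced_map g' ?K f (induced_J g J k A) = induced_J g' J' k (induced_map g' ?K f A)"
    if A: "A \<in> carrier (quotient_k g J k)" for A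
  proof -
    obtain X where "X \<in> carrier g" "A = class_k g J k X" using A by (auto simp: I.carrier_quotient)
    then show ?thesis
      using lie_linear_mapD(1)[OF J_lin] lie_linear_mapD(1)[OF f_lin]
      by (simp add: induced_J induced_J' induced_f fJ)
  qed
  show ?thesis
    unfolding Let_def
    using I.lie_algebra_quotient lie_ideal.lie_algebra_quotient[OF K] induced_J induced_J' induced_f
      complex_structure_quotient[OF I J JI] complex_structure_quotient[OF K J' JK]
      lie_algebra_iso_quotient[OF I K assms(7) transport] commute
    by blast
qed

end
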